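(* Let $M$ be a monoid with monoid presentation $\langle X_M : R_M\rangle$ via a surjective morphism $\phi_M:X_M^*\to M$, and write $\overline x=x\phi_M$ for $x\in X_M$. Let $n\ge 1$. Let $X'$ be the alphabet $X'=\{s_1,\ldots,s_{n-1},e\}\cup X_M$ (disjoint union). Let $R'$ be the set of relations over $X'$ consisting of all the relations in $R_M$ together with the following, where $x,y\in X_M$, the subscripts range over all values for which the letters are defined (so a relation involving an undefined letter is omitted), subject to the stated constraints, and $\iota$ is the empty word: (1) $s_i^2=\iota$; (2) $s_is_j=s_js_i$ if $|i-j|>1$; (3) $s_is_js_i=s_js_is_j$ if $|i-j|=1$; (4) $e^2=e$; (5) $es_1es_1=es_1e=s_1es_1e$; (6) $es_i=s_ie$ if $i\ge2$; (7) $s_ix=xs_i$ if $i\ge2$; (8) $xs_1ys_1=s_1ys_1x$; (9) $es_1xs_1=s_1xs_1e$; (10) $ex=xe=e$. Let $\phi':(X')^*\to M\wr\mathcal I_n$ be the monoid morphism determined by - $s_i\mapsto((1,\ldots,1),(i,i+1))$, where $(i,i+1)$ is the transposition swapping $i$ and $i+1$; - $e\mapsto((0,1,\ldots,1),\mathrm{id}_{\{2,\ldots,n\}})$; - $x\mapsto((\overline x,1,\ldots,1),\mathrm{id}_{\{1,\ldots,n\}})$ for $x\in X_M$. Then the wreath product $M\wr\mathcal I_n$ has monoid presentation $\langle X':R'\rangle$ via $\phi'$.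
   Context: Write $\mathbf n=\{1,\ldots,n\}$. The symmetric inverse monoid $\mathcal I_n$ is the monoid of all injective partial maps $\mathbf n\to\mathbf n$ under composition of partial maps, composed left to right ($i(\alpha\beta)=(i\alpha)\beta$). For $A\subseteq\mathbf n$, $\mathrm{id}_A\in\mathcal I_n$ is the identity map on $A$. $M_0=M\cup\{0\}$ is obtained from $M$ (with identity $1$) by adjoining a new symbol $0$ as a zero element (even if $M$ already has a zero). $M_0^n$ is the direct power (componentwise product). For $\mathbf a=(a_1,\ldots,a_n)\in M_0^n$, $\mathrm{supp}(\mathbf a)=\{i\in\mathbf n:a_i\ne0\}$. For $\alpha\in\mathcal I_n$ and $\mathbf a\in M_0^n$, ${}^\alpha\mathbf a=(b_1,\ldots,b_n)$ where $b_i=a_{i\alpha}$ if $i\in\mathrm{dom}(\alpha)$ and $b_i=0$ otherwise. The wreath product is the monoid $$M\wr\mathcal I_n=\{(\mathbf a,\alpha)\in M_0^n\times\mathcal I_n:\mathrm{supp}(\mathbf a)=\mathrm{dom}(\alpha)\},\qquad (\mathbf a,\alpha)(\mathbf b,\beta)=(\mathbf a\cdot{}^\alpha\mathbf b,\ \alpha\beta).$$ Presentations: $X^*$ is the free monoid over $X$. For $R\subseteq X^*\times X^*$, $R^\sharp$ denotes the congruence on $X^*$ generated by $R$; a relation $(u,v)$ is written $u=v$. A monoid $N$ has monoid presentation $\langle X:R\rangle$ via $\phi$ if $\phi:X^*\to N$ is a surjective monoid morphism whose kernel $\{(u,v):u\phi=v\phi\}$ equals $R^\sharp$. *)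

theory Defs
  imports "HOL-Algebra.Product_Groups" "HOL-Combinatorics.Transposition"
begin

section \<open>Monoid presentations\<close>

definition free_monoid :: "'x set \<Rightarrow> 'x list monoid"
  where "free_monoid A = \<lparr>carrier = lists A, monoid.mult = (@), one = []\<rparr>"

definition monoid_congruence :: "('a, 'b) monoid_scheme \<Rightarrow> ('a \<times> 'a) set \<Rightarrow> bool"
  where "monoid_congruence G \<rho> \<longleftrightarrow>
    equiv (carrier G) \<rho> \<and>
    (\<forall>a b c. (a, b) \<in> \<rho> \<and> c \<in> carrier G \<longrightarrow>
      (c \<otimes>\<^bsub>G\<^esub> a, c \<otimes>\<^bsub>G\<^esub> b) \<in> \<rho> \<and> (a \<otimes>\<^bsub>G\<^esub> c, b \<otimes>\<^bsub>G\<^esub> c) \<in> \<rho>)"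

definition generated_congruence ::
    "('a, 'b) monoid_scheme \<Rightarrow> ('a \<times> 'a) set \<Rightarrow> ('a \<times> 'a) set"
  where "generated_congruence G R = \<Inter> {\<rho>. monoid_congruence G \<rho> \<and> R \<subseteq> \<rho>}"

text \<open>The library's \<^const>\<open>hom\<close> does not require preservation of the identity,
  hence the separate conjunct.\<close>

definition has_presentation ::
    "('a, 'b) monoid_scheme \<Rightarrow> 'x set \<Rightarrow> ('x list \<times> 'x list) set \<Rightarrow> ('x list \<Rightarrow> 'a) \<Rightarrow> bool"
  where "has_presentation N A R \<phi> \<longleftrightarrow>
    monoid N \<and>
    R \<subseteq> lists A \<times> lists A \<and>
    \<phi> \<in> hom (free_monoid A) N \<and> \<phi> [] = \<one>\<^bsub>N\<^esub> \<and>
    \<phi> ` lists A = carrier N \<and>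
    {(u, v). u \<in> lists A \<and> v \<in> lists A \<and> \<phi> u = \<phi> v} = generated_congruence (free_monoid A) R"

text \<open>The morphism from a free monoid determined by the images \<open>f x\<close> of the letters.\<close>

definition word_morphism :: "('a, 'b) monoid_scheme \<Rightarrow> ('x \<Rightarrow> 'a) \<Rightarrow> 'x list \<Rightarrow> 'a"
  where "word_morphism N f w = foldr (\<otimes>\<^bsub>N\<^esub>) (map f w) \<one>\<^bsub>N\<^esub>"


section \<open>The symmetric inverse monoid\<close>

definition id_part :: "nat set \<Rightarrow> nat \<rightharpoonup> nat"
  where "id_part A = Some |` A"

text \<open>Partial maps are composed from left to right, so \<open>\<alpha> \<beta>\<close> is \<open>\<beta> \<circ>\<^sub>m \<alpha>\<close>.\<close>

definition sym_inv_monoid :: "nat \<Rightarrow> (nat \<rightharpoonup> nat) monoid"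
  where "sym_inv_monoid n =
    \<lparr>carrier = {\<alpha>. dom \<alpha> \<subseteq> {1..n} \<and> ran \<alpha> \<subseteq> {1..n} \<and> inj_on \<alpha> (dom \<alpha>)},
     monoid.mult = (\<lambda>\<alpha> \<beta>. \<beta> \<circ>\<^sub>m \<alpha>),
     one = id_part {1..n}\<rparr>"


section \<open>The wreath product\<close>

text \<open>The element \<open>None\<close> is the new zero, which is distinct from any zero of \<open>M\<close>.\<close>

definition adjoin_zero :: "('m, 'b) monoid_scheme \<Rightarrow> 'm option monoid"
  where "adjoin_zero M =
    \<lparr>carrier = insert None (Some ` carrier M),
     monoid.mult = (\<lambda>a b. case (a, b) of (Some x, Some y) \<Rightarrow> Some (x \<otimes>\<^bsub>M\<^esub> y) | _ \<Rightarrow> None),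
     one = Some \<one>\<^bsub>M\<^esub>\<rparr>"

text \<open>The underlying set of \<^const>\<open>product_group\<close> consists of extensional functions on the index
  set. The definition makes sense for arbitrary monoids.\<close>

definition zero_power :: "('m, 'b) monoid_scheme \<Rightarrow> nat \<Rightarrow> (nat \<Rightarrow> 'm option) monoid"
  where "zero_power M n = product_group {1..n} (\<lambda>_. adjoin_zero M)"

definition supp :: "nat \<Rightarrow> (nat \<Rightarrow> 'm option) \<Rightarrow> nat set"
  where "supp n a = {i \<in> {1..n}. a i \<noteq> None}"

definition act :: "nat \<Rightarrow> (nat \<rightharpoonup> nat) \<Rightarrow> (nat \<Rightarrow> 'm option) \<Rightarrow> nat \<Rightarrow> 'm option"
  where "act n \<alpha> a = (\<lambda>i\<in>{1..n}. case \<alpha> i of Some j \<Rightarrow> a j | None \<Rightarrow> None)"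

definition wreath ::
    "('m, 'b) monoid_scheme \<Rightarrow> nat \<Rightarrow> ((nat \<Rightarrow> 'm option) \<times> (nat \<rightharpoonup> nat)) monoid"
  where "wreath M n =
    \<lparr>carrier = {(a, \<alpha>). a \<in> carrier (zero_power M n) \<and> \<alpha> \<in> carrier (sym_inv_monoid n) \<and>
                        supp n a = dom \<alpha>},
     monoid.mult = (\<lambda>(a, \<alpha>) (b, \<beta>).
       (a \<otimes>\<^bsub>zero_power M n\<^esub> act n \<alpha> b, \<alpha> \<otimes>\<^bsub>sym_inv_monoid n\<^esub> \<beta>)),
     one = (\<one>\<^bsub>zero_power M n\<^esub>, \<one>\<^bsub>sym_inv_monoid n\<^esub>)\<rparr>"


section \<open>The presentation of the wreath product\<close>

datatype 'x letter = LetS nat | LetE | LetX 'x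

definition wreath_letters :: "nat \<Rightarrow> 'x set \<Rightarrow> 'x letter set"
  where "wreath_letters n A = LetS ` {1..<n} \<union> {LetE} \<union> LetX ` A"

text \<open>The subscripts of the letters \<open>s\<^sub>i\<close> range over \<open>1, \<dots>, n - 1\<close>; the conditions
  \<open>1 < n\<close> below express that the letter \<open>s\<^sub>1\<close> is defined.
  A chain \<open>u = v = w\<close> contributes the two relations \<open>u = v\<close> and \<open>v = w\<close>.\<close>

definition wreath_relations ::
    "nat \<Rightarrow> 'x set \<Rightarrow> ('x list \<times> 'x list) set \<Rightarrow> ('x letter list \<times> 'x letter list) set"
  where "wreath_relations n A R = (let s = LetS; e = LetE; x' = LetX; I = {1..<n} in
    {(map x' u, map x' v) | u v. (u, v) \<in> R} \<union>
    {([s i, s i], []) | i. i \<in> I} \<union>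
    {([s i, s j], [s j, s i]) | i j. i \<in> I \<and> j \<in> I \<and> \<bar>int i - int j\<bar> > 1} \<union>
    {([s i, s j, s i], [s j, s i, s j]) | i j. i \<in> I \<and> j \<in> I \<and> \<bar>int i - int j\<bar> = 1} \<union>
    {([e, e], [e])} \<union>
    (if 1 < n then
      {([e, s 1, e, s 1], [e, s 1, e]), ([e, s 1, e], [s 1, e, s 1, e])} else {}) \<union>
    {([e, s i], [s i, e]) | i. i \<in> I \<and> i \<ge> 2} \<union>
    {([s i, x' x], [x' x, s i]) | i x. i \<in> I \<and> i \<ge> 2 \<and> x \<in> A} \<union>
    {([x' x, s 1, x' y, s 1], [s 1, x' y, s 1, x' x]) | x y. x \<in> A \<and> y \<in> A \<and> 1 < n} \<union>
    {([e, s 1, x' x, s 1], [s 1, x' x, s 1, e]) | x. x \<in> A \<and> 1 < n} \<union>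
    {([e, x' x], [x' x, e]) | x. x \<in> A} \<union>
    {([x' x, e], [e]) | x. x \<in> A})"

fun wreath_letter_image ::
    "('m, 'b) monoid_scheme \<Rightarrow> nat \<Rightarrow> ('x list \<Rightarrow> 'm) \<Rightarrow> 'x letter \<Rightarrow>
     (nat \<Rightarrow> 'm option) \<times> (nat \<rightharpoonup> nat)"
  where
    "wreath_letter_image M n \<phi> (LetS i) =
       (\<lambda>k\<in>{1..n}. Some \<one>\<^bsub>M\<^esub>, (\<lambda>k. Some (transpose i (i + 1) k)) |` {1..n})"
  | "wreath_letter_image M n \<phi> LetE =
       (\<lambda>k\<in>{1..n}. if k = 1 then None else Some \<one>\<^bsub>M\<^esub>, id_part {2..n})"
  | "wreath_letter_image M n \<phi> (LetX x) =
       (\<lambda>k\<in>{1..n}. if k = 1 then Some (\<phi> [x]) else Some \<one>\<^bsub>M\<^esub>, id_part {1..n})"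

end

theory Submission
  imports Defs
begin

text \<open>
  An element of the wreath product is an \<open>n \<times> n\<close> matrix over \<open>M\<close> with an added zero, having at
  most one nonzero entry in each row and each column. Its row \<open>i\<close> is read off by letting a word
  act on the state \<open>(1, i)\<close>: a state \<open>(m, i)\<close> is an entry \<open>m\<close> standing in column \<open>i\<close>, the letter
  \<open>s\<^sub>k\<close> swaps the columns \<open>k\<close> and \<open>k + 1\<close>, while \<open>x\<close> multiplies an entry standing in column \<open>1\<close>
  and \<open>e\<close> deletes it. Two words have the same image exactly if they act in the same way on all
  states (\<open>element_eq_iff\<close>), and all defining relations are respected by the action.

  What remains is that words with the same action are congruent. This goes by induction on \<open>n\<close>,
  peeling off the last row of the matrix. The word
  \<open>s\<^bsub>n-1\<^esub> \<dots> s\<^sub>1 y s\<^sub>1 \<dots> s\<^bsub>j-1\<^esub>\<close>, where \<open>y\<close> is \<open>e\<close> or a word over the generators of \<open>M\<close>, has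
  the entry \<open>y\<close> in row \<open>n\<close> and column \<open>j\<close> and is otherwise an identity matrix with a
  column inserted. Multiplying such a word on the right by a letter produces, modulo the relations,
  another one with a word over the letters of rank \<open>n - 1\<close> on its left
  (\<open>last_row_times_letter\<close>). So every word is congruent to such a product (\<open>normal_form\<close>).
  Given two of these with the same action, compare the last rows. If the last rows are nonzero,
  the columns \<open>j\<close> agree and the entries are equal in \<open>M\<close>, hence congruent by the relations of
  \<open>M\<close>; the left factors then have the same action and the induction hypothesis applies.

  If the last rows are zero, the columns \<open>j < k\<close> may differ. This case is settled by the relations
  \<open>e s\<^sub>1 e s\<^sub>1 = e s\<^sub>1 e = s\<^sub>1 e s\<^sub>1 e\<close>. Both columns of the matrix are zero, so the
  left factor has a zero column too. By the induction hypothesis it absorbs the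
  diagonal idempotent deleting that column, and with this idempotent in front, \<open>j\<close> may be replaced
  by \<open>k\<close> (\<open>zero_row_exchange\<close>, \<open>cong_zero_last_row\<close>).

  The same peeling of the last row shows that every matrix is the image of a word
  (\<open>realize_rows\<close>).
\<close>

section \<open>Congruences generated by relations on words\<close>

text \<open>Contexts range over all words, not only those over a given alphabet, so that rewriting needs
  no membership conditions. On words over an alphabet that supports the relations this is still the
  generated congruence (\<open>generated_congruence_free_monoid\<close> below).\<close>

inductive cong :: "('x list \<times> 'x list) set \<Rightarrow> 'x list \<Rightarrow> 'x list \<Rightarrow> bool" for R where
  base: "(u, v) \<in> R \<Longrightarrow> cong R u v"
| refl [simp, intro]: "cong R u u"
| sym: "cong R u v \<Longrightarrow> cong R v u"
| trans [trans]: "cong R u v \<Longrightarrow> cong R v w \<Longrightarrow> cong R u w"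
| append: "cong R u v \<Longrightarrow> cong R p q \<Longrightarrow> cong R (u @ p) (v @ q)"

lemma cong_context: "cong R u v \<Longrightarrow> cong R (p @ u @ q) (p @ v @ q)"
  by (intro cong.append cong.refl)

lemma cong_mono:
  assumes "cong R u v" "R \<subseteq> S"
  shows "cong S u v"
  using assms(1) by induction (use assms(2) in \<open>auto intro: cong.intros\<close>)

lemma cong_lists_iff:
  assumes "cong R u v" "R \<subseteq> lists A \<times> lists A"
  shows "u \<in> lists A \<longleftrightarrow> v \<in> lists A"
  using assms(1) by induction (use assms(2) in auto)

lemma monoid_congruence_cong:
  "monoid_congruence (free_monoid A) {(u, v). u \<in> lists A \<and> v \<in> lists A \<and> cong R u v}"
  unfolding monoid_congruence_def free_monoid_def equiv_def refl_on_def sym_def trans_def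
  by (auto intro: cong.sym cong.trans cong.append)

text \<open>A derivation that starts at a word over \<open>A\<close> never leaves the words over \<open>A\<close>, because
  neither side of a relation contains other letters.\<close>

lemma cong_in_congruence:
  assumes "cong R u v" "R \<subseteq> lists A \<times> lists A"
    and \<rho>: "monoid_congruence (free_monoid A) \<rho>" "R \<subseteq> \<rho>" and "u \<in> lists A"
  shows "(u, v) \<in> \<rho>"
  using assms(1,5)
proof induction
  case (sym u v)
  then show ?case
    using \<rho>(1) cong_lists_iff[OF sym.hyps assms(2)]
    unfolding monoid_congruence_def equiv_def sym_def by blast
next
  case (trans u v w)
  then show ?case
    using \<rho>(1) cong_lists_iff[OF trans.hyps(1) assms(2)]
    unfolding monoid_congruence_def equiv_def trans_def by blast
next
  case (append u v p q)
  then have "(u, v) \<in> \<rho>" "(p, q) \<in> \<rho>" "p \<in> lists A" "v \<in> lists A"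
    using cong_lists_iff[OF append.hyps(1) assms(2)] by auto
  then have "(u @ p, v @ p) \<in> \<rho>" "(v @ p, v @ q) \<in> \<rho>"
    using \<rho>(1) unfolding monoid_congruence_def free_monoid_def by auto
  then show ?case
    using \<rho>(1) unfolding monoid_congruence_def equiv_def trans_def by blast
next
  case (refl u)
  then show ?case
    using \<rho>(1) unfolding monoid_congruence_def equiv_def refl_on_def free_monoid_def by auto
qed (use \<rho>(2) in auto)

lemma generated_congruence_free_monoid:
  assumes "R \<subseteq> lists A \<times> lists A"
  shows "generated_congruence (free_monoid A) R =
    {(u, v). u \<in> lists A \<and> v \<in> lists A \<and> cong R u v}" (is "?G = ?C")
proof
  have "R \<subseteq> ?C"
    using assms by (auto intro: cong.base)
  then show "?G \<subseteq> ?C"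
    unfolding generated_congruence_def using monoid_congruence_cong by blast
  show "?C \<subseteq> ?G"
    unfolding generated_congruence_def using cong_in_congruence[OF _ assms] by blast
qed

section \<open>Rewriting with the relations of the wreath product\<close>

abbreviation S :: "nat \<Rightarrow> 'x letter" where "S \<equiv> LetS"
abbreviation E :: "'x letter" where "E \<equiv> LetE"
abbreviation X :: "'x \<Rightarrow> 'x letter" where "X \<equiv> LetX"

text \<open>The permutation \<open>up j\<close> moves \<open>1\<close> to \<open>j\<close> and shifts \<open>2, \<dots>, j\<close> down by one; \<open>down j\<close> is its
  inverse.\<close>

definition up :: "nat \<Rightarrow> 'x letter list" where "up j = map S [1..<j]"
definition down :: "nat \<Rightarrow> 'x letter list" where "down j = map S (rev [1..<j])"

text \<open>The letters acting only at the point \<open>1\<close>.\<close>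

definition point_letters :: "'x set \<Rightarrow> 'x letter set" where "point_letters A = insert E (X ` A)"

text \<open>The words that represent the entries of a matrix: the zero entry is the single word \<open>e\<close>,
  the others are given by words over the generators of \<open>M\<close>.\<close>

definition entry :: "'x set \<Rightarrow> 'x letter list set" where "entry A = insert [E] (lists (X ` A))"

text \<open>The matrix with entry \<open>y\<close> in row \<open>n\<close> and column \<open>j\<close>, whose other rows are those of an
  identity matrix of size \<open>n - 1\<close> spread over the remaining columns in increasing order.\<close>

definition last_row :: "nat \<Rightarrow> 'x letter list \<Rightarrow> nat \<Rightarrow> 'x letter list" where
  "last_row n y j = down n @ y @ up j"

text \<open>In rank \<open>0\<close> the wreath product is trivial and must have no generators for the induction to
  start there, whereas \<^term>\<open>wreath_letters 0 A\<close> contains \<open>e\<close> and the generators of \<open>M\<close>.\<close>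

definition letters :: "nat \<Rightarrow> 'x set \<Rightarrow> 'x letter set" where
  "letters n A = (if n = 0 then {} else wreath_letters n A)"

context
  fixes n :: nat and A :: "'x set" and R :: "('x list \<times> 'x list) set"
begin

abbreviation weq (infix "\<approx>" 50) where
  "u \<approx> v \<equiv> cong (wreath_relations n A R) u v"

lemma base_relations:
  shows s_square: "i \<in> {1..<n} \<Longrightarrow> [S i, S i] \<approx> []"
    and s_commute: "i \<in> {1..<n} \<Longrightarrow> j \<in> {1..<n} \<Longrightarrow> i + 1 < j \<or> j + 1 < i \<Longrightarrow> [S i, S j] \<approx> [S j, S i]"
    and s_braid: "i \<in> {1..<n} \<Longrightarrow> j \<in> {1..<n} \<Longrightarrow> i = j + 1 \<or> j = i + 1 \<Longrightarrow>
      [S i, S j, S i] \<approx> [S j, S i, S j]"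
    and e_square: "[E, E] \<approx> [E]"
    and ese_s: "1 < n \<Longrightarrow> [E, S 1, E, S 1] \<approx> [E, S 1, E]"
    and s_ese: "1 < n \<Longrightarrow> [E, S 1, E] \<approx> [S 1, E, S 1, E]"
    and e_s: "i \<in> {2..<n} \<Longrightarrow> [E, S i] \<approx> [S i, E]"
    and s_x: "i \<in> {2..<n} \<Longrightarrow> x \<in> A \<Longrightarrow> [S i, X x] \<approx> [X x, S i]"
    and x_sys: "1 < n \<Longrightarrow> x \<in> A \<Longrightarrow> y \<in> A \<Longrightarrow> [X x, S 1, X y, S 1] \<approx> [S 1, X y, S 1, X x]"
    and e_sxs: "1 < n \<Longrightarrow> x \<in> A \<Longrightarrow> [E, S 1, X x, S 1] \<approx> [S 1, X x, S 1, E]"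
    and e_x: "x \<in> A \<Longrightarrow> [E, X x] \<approx> [X x, E]"
    and x_e: "x \<in> A \<Longrightarrow> [X x, E] \<approx> [E]"
  by (rule cong.base, fastforce simp: wreath_relations_def Let_def)+

lemma image_relation: "cong R u v \<Longrightarrow> map X u \<approx> map X v"
proof (induction rule: cong.induct)
  case (base u v)
  then show ?case
    by (intro cong.base) (auto simp: wreath_relations_def Let_def)
qed (auto intro: cong.sym cong.trans cong.append)

lemma pass_letters:
  assumes "\<And>c. c \<in> set w \<Longrightarrow> [f c] @ t \<approx> t @ [g c]"
  shows "map f w @ t \<approx> t @ map g w"
  using assms
proof (induction w)
  case (Cons c w)
  have "map f (c # w) @ t \<approx> [f c] @ t @ map g w"
    using cong_context[OF Cons.IH, of "[f c]" "[]"] Cons.prems by simp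
  also have "\<dots> \<approx> t @ map g (c # w)"
    using cong_context[OF Cons.prems[of c], of "[]" "map g w"] by simp
  finally show ?case .
qed simp

lemma commute_letters:
  assumes "\<And>c. c \<in> set w \<Longrightarrow> [c] @ t \<approx> t @ [c]"
  shows "w @ t \<approx> t @ w"
  using pass_letters[of w "\<lambda>c. c" t "\<lambda>c. c"] assms by simp

lemma up_Suc: "1 \<le> j \<Longrightarrow> up (Suc j) = up j @ [S j]"
  and down_Suc: "1 \<le> j \<Longrightarrow> down (Suc j) = S j # down j"
  by (simp_all add: up_def down_def)

lemma up_1 [simp]: "up (Suc 0) = []"
  and down_1 [simp]: "down (Suc 0) = []"
  by (simp_all add: up_def down_def)

lemma up_Cons: "2 \<le> j \<Longrightarrow> up j = S 1 # map S [2..<j]"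
  and down_snoc: "2 \<le> j \<Longrightarrow> down j = map S (rev [2..<j]) @ [S 1]"
  by (simp_all add: up_def down_def upt_conv_Cons numeral_2_eq_2)

lemma up_down_cancel: "1 \<le> m \<Longrightarrow> m \<le> n \<Longrightarrow> up m @ down m \<approx> []"
proof (induction m rule: dec_induct)
  case (step m)
  have "up (Suc m) @ down (Suc m) \<approx> up m @ down m"
    using cong_context[OF s_square[of m], of "up m" "down m"] step by (simp add: up_Suc down_Suc)
  also have "\<dots> \<approx> []"
    using step by simp
  finally show ?case .
qed simp

lemma down_up_cancel: "1 \<le> m \<Longrightarrow> m \<le> n \<Longrightarrow> down m @ up m \<approx> []"
proof (induction m rule: dec_induct)
  case (step m)
  have "down (Suc m) @ up (Suc m) \<approx> [S m, S m]"
    using cong_context[OF step.IH, of "[S m]" "[S m]"] step by (simp add: up_Suc down_Suc)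
  also have "\<dots> \<approx> []"
    using step by (intro s_square) auto
  finally show ?case .
qed simp

lemma up_s_far:
  assumes "j < k" "k < n"
  shows "up j @ [S k] \<approx> [S k] @ up j"
  by (rule commute_letters) (use assms in \<open>auto simp: up_def intro!: s_commute\<close>)

lemma down_s_far:
  assumes "j < k" "k < n"
  shows "down j @ [S k] \<approx> [S k] @ down j"
  by (rule commute_letters) (use assms in \<open>auto simp: down_def intro!: s_commute\<close>)

text \<open>The letter \<open>s\<^sub>k\<close> commutes with the letters above \<open>s\<^bsub>k+1\<^esub>\<close>, is turned into \<open>s\<^bsub>k+1\<^esub>\<close> by the
  braid relation \<open>s\<^sub>k s\<^bsub>k+1\<^esub> s\<^sub>k = s\<^bsub>k+1\<^esub> s\<^sub>k s\<^bsub>k+1\<^esub>\<close>, and then commutes with the letters below \<open>s\<^sub>k\<close>.\<close>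

lemma s_down:
  assumes "1 \<le> k" "Suc k < m" "m \<le> n"
  shows "[S k] @ down m \<approx> down m @ [S (Suc k)]"
proof -
  have "Suc (Suc k) \<le> m" using assms by simp
  then show ?thesis using assms(3)
  proof (induction m rule: dec_induct)
    case base
    have "[S k] @ down (Suc (Suc k)) \<approx> [S (Suc k), S k, S (Suc k)] @ down k"
      using cong_context[OF s_braid[of k "Suc k"], of "[]" "down k"] assms(1) base by (simp add: down_Suc)
    also have "\<dots> \<approx> [S (Suc k), S k] @ down k @ [S (Suc k)]"
      using cong_context[OF cong.sym[OF down_s_far[of k "Suc k"]], of "[S (Suc k), S k]" "[]"] base by simp
    finally show ?case using assms(1) by (simp add: down_Suc)
  next
    case (step m)
    have "[S k] @ down (Suc m) \<approx> [S m, S k] @ down m"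
      using cong_context[OF s_commute[of k m], of "[]" "down m"] step assms(1) by (simp add: down_Suc)
    also have "\<dots> \<approx> [S m] @ down m @ [S (Suc k)]"
      using cong_context[OF step.IH, of "[S m]" "[]"] step by simp
    finally show ?case using step assms(1) by (simp add: down_Suc)
  qed
qed

lemma up_s:
  assumes "1 \<le> k" "Suc k < m" "m \<le> n"
  shows "up m @ [S k] \<approx> [S (Suc k)] @ up m"
proof -
  have "up m @ [S k] \<approx> up m @ [S k] @ down m @ up m"
    using cong_context[OF cong.sym[OF down_up_cancel[of m]], of "up m @ [S k]" "[]"] assms by simp
  also have "\<dots> \<approx> up m @ down m @ [S (Suc k)] @ up m"
    using cong_context[OF s_down[of k m], of "up m" "up m"] assms by simp
  also have "\<dots> \<approx> [S (Suc k)] @ up m"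
    using cong_context[OF up_down_cancel[of m], of "[]" "[S (Suc k)] @ up m"] assms by simp
  finally show ?thesis .
qed

lemma point_s: "c \<in> point_letters A \<Longrightarrow> 2 \<le> k \<Longrightarrow> k < n \<Longrightarrow> [S k] @ [c] \<approx> [c] @ [S k]"
  unfolding point_letters_def by (auto intro: s_x cong.sym[OF e_s])

text \<open>Anything at the point \<open>1\<close> commutes with anything at the point \<open>2\<close>. For two generators of \<open>M\<close>
  and for \<open>e\<close> at \<open>1\<close> against a generator at \<open>2\<close> this is a relation; for \<open>e\<close> against \<open>e\<close> both sides
  equal \<open>e s\<^sub>1 e\<close>; the remaining case is the conjugate by \<open>s\<^sub>1\<close> of the second one.\<close>

lemma point_conj:
  assumes "1 < n" "c \<in> point_letters A" "d \<in> point_letters A"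
  shows "[c] @ [S 1, d, S 1] \<approx> [S 1, d, S 1] @ [c]"
proof -
  have "[E, S 1, E, S 1] \<approx> [S 1, E, S 1, E]"
    using ese_s[OF assms(1)] s_ese[OF assms(1)] by (rule cong.trans)
  moreover have "[X x, S 1, E, S 1] \<approx> [S 1, E, S 1, X x]" if x: "x \<in> A" for x
  proof -
    have ss: "[S 1, S 1] \<approx> []"
      using assms(1) by (intro s_square) auto
    have "[X x, S 1, E, S 1] \<approx> [S 1, S 1, X x, S 1, E, S 1]"
      using cong_context[OF cong.sym[OF ss], of "[]" "[X x, S 1, E, S 1]"] by simp
    also have "\<dots> \<approx> [S 1, E, S 1, X x, S 1, S 1]"
      using cong_context[OF cong.sym[OF e_sxs[OF assms(1) x]], of "[S 1]" "[S 1]"] by simp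
    also have "\<dots> \<approx> [S 1, E, S 1, X x]"
      using cong_context[OF ss, of "[S 1, E, S 1, X x]" "[]"] by simp
    finally show ?thesis .
  qed
  ultimately show ?thesis
    using assms e_sxs x_sys unfolding point_letters_def by auto
qed

lemma point_down:
  assumes "c \<in> point_letters A" "2 \<le> m" "m \<le> n"
  shows "[c] @ down m \<approx> down m @ [S 1, c, S 1]"
proof -
  let ?V = "map S (rev [2..<m])"
  have "?V @ [c] \<approx> [c] @ ?V"
    by (rule commute_letters) (use assms point_s in auto)
  then have "[c] @ down m \<approx> ?V @ [c, S 1]"
    using cong_context[OF cong.sym, of _ "?V @ [c]" "[c] @ ?V" "[]" "[S 1]"] assms by (simp add: down_snoc)
  also have "\<dots> \<approx> ?V @ [S 1, S 1, c, S 1]"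
    using cong_context[OF cong.sym[OF s_square[of 1]], of "?V" "[c, S 1]"] assms by simp
  finally show ?thesis using assms by (simp add: down_snoc)
qed

lemma up_point:
  assumes "c \<in> point_letters A" "2 \<le> m" "m \<le> n"
  shows "up m @ [c] \<approx> [S 1, c, S 1] @ up m"
proof -
  let ?V = "map S [2..<m]"
  have "?V @ [c] \<approx> [c] @ ?V"
    by (rule commute_letters) (use assms point_s in auto)
  then have "up m @ [c] \<approx> [S 1, c] @ ?V"
    using cong_context[of _ "?V @ [c]" "[c] @ ?V" "[S 1]" "[]"] assms by (simp add: up_Cons)
  also have "\<dots> \<approx> [S 1, c, S 1, S 1] @ ?V"
    using cong_context[OF cong.sym[OF s_square[of 1]], of "[S 1, c]" "?V"] assms by simp
  finally show ?thesis using assms by (simp add: up_Cons)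
qed

lemma entry_letters: "y \<in> entry A \<Longrightarrow> c \<in> set y \<Longrightarrow> c \<in> point_letters A"
  unfolding entry_def point_letters_def by auto

lemma entry_s: "y \<in> entry A \<Longrightarrow> 2 \<le> k \<Longrightarrow> k < n \<Longrightarrow> y @ [S k] \<approx> [S k] @ y"
  by (rule commute_letters) (meson cong.sym entry_letters point_s)

lemma entry_conj:
  "y \<in> entry A \<Longrightarrow> 1 < n \<Longrightarrow> c \<in> point_letters A \<Longrightarrow> y @ [S 1, c, S 1] \<approx> [S 1, c, S 1] @ y"
  by (rule commute_letters) (meson entry_letters point_conj)

lemma x_word_e: "w \<in> lists (X ` A) \<Longrightarrow> w @ [E] \<approx> [E]"
proof (induction w)
  case (Cons c w)
  then obtain x where x: "c = X x" "x \<in> A" by auto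
  have "(c # w) @ [E] \<approx> [c, E]"
    using cong_context[OF Cons.IH, of "[c]" "[]"] Cons.prems by simp
  also have "\<dots> \<approx> [E]"
    using x x_e by simp
  finally show ?case .
qed simp

lemma entry_times_point:
  assumes "y \<in> entry A" "c \<in> point_letters A"
  shows "\<exists>z\<in>entry A. y @ [c] \<approx> z"
proof (cases "y = [E]")
  case True
  have "[E, c] \<approx> [E]"
    using assms(2) e_square cong.trans[OF e_x x_e] unfolding point_letters_def by auto
  then show ?thesis
    using True by (auto simp: entry_def)
next
  case False
  then have y: "y \<in> lists (X ` A)"
    using assms(1) by (simp add: entry_def)
  show ?thesis
  proof (cases "c = E")
    case True
    then show ?thesis
      using x_word_e[OF y] by (auto simp: entry_def)
  next
    case False
    then have "y @ [c] \<in> entry A"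
      using y assms(2) by (auto simp: entry_def point_letters_def)
    then show ?thesis by blast
  qed
qed

lemma last_row_cong: "y \<approx> z \<Longrightarrow> last_row n y j \<approx> last_row n z j"
  unfolding last_row_def by (rule cong_context)

text \<open>A letter that becomes \<open>s\<^bsub>k+1\<^esub>\<close> on its way through \<open>up j\<close> passes the entry unchanged, since it
  does not touch the point \<open>1\<close>, and is lowered to \<open>s\<^sub>k\<close> by \<open>down n\<close>.\<close>

lemma last_row_s_shift:
  assumes "y \<in> entry A" "1 \<le> k" "Suc k < n" "up j @ [c] \<approx> [S (Suc k)] @ up j"
  shows "last_row n y j @ [c] \<approx> [S k] @ last_row n y j"
proof -
  have "last_row n y j @ [c] \<approx> down n @ y @ [S (Suc k)] @ up j"
    using cong_context[OF assms(4), of "down n @ y" "[]"] by (simp add: last_row_def)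
  also have "\<dots> \<approx> down n @ [S (Suc k)] @ y @ up j"
    using cong_context[OF entry_s[of y "Suc k"], of "down n" "up j"] assms by simp
  also have "\<dots> \<approx> [S k] @ last_row n y j"
    using cong_context[OF cong.sym[OF s_down[of k n]], of "[]" "y @ up j"] assms by (simp add: last_row_def)
  finally show ?thesis .
qed

text \<open>For \<open>j \<ge> 2\<close> column \<open>1\<close> belongs to row \<open>1\<close>, so a letter acting on column \<open>1\<close> from
  the right acts on row \<open>1\<close> from the left.\<close>

lemma last_row_point_shift:
  assumes "y \<in> entry A" "c \<in> point_letters A" "2 \<le> j" "j \<le> n"
  shows "last_row n y j @ [c] \<approx> [c] @ last_row n y j"
proof -
  have "last_row n y j @ [c] \<approx> down n @ y @ [S 1, c, S 1] @ up j"
    using cong_context[OF up_point[of c j], of "down n @ y" "[]"] assms by (simp add: last_row_def)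
  also have "\<dots> \<approx> down n @ [S 1, c, S 1] @ y @ up j"
    using cong_context[OF entry_conj[of y c], of "down n" "up j"] assms by simp
  also have "\<dots> \<approx> [c] @ last_row n y j"
    using cong_context[OF cong.sym[OF point_down[of c n]], of "[]" "y @ up j"] assms
    by (simp add: last_row_def)
  finally show ?thesis .
qed

lemma letters_cases:
  assumes "c \<in> letters n A"
  obtains k where "c = S k" "1 \<le> k" "k < n" | "c \<in> point_letters A" "1 \<le> n"
  using assms by (auto simp: letters_def wreath_letters_def point_letters_def split: if_splits)

lemma S_in_letters: "1 \<le> k \<Longrightarrow> Suc k < n \<Longrightarrow> S k \<in> letters (n - 1) A"
  by (auto simp: letters_def wreath_letters_def)

text \<open>The letters \<open>s\<^bsub>j-1\<^esub>\<close> and \<open>s\<^sub>j\<close> move the column of the last entry, and a letter acting at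
  column \<open>1\<close> changes this entry if \<open>j = 1\<close>. Every other letter leaves the last row alone and passes
  to the left, where it becomes a letter of rank \<open>n - 1\<close>.\<close>

lemma last_row_times_letter:
  assumes y: "y \<in> entry A" and j: "1 \<le> j" "j \<le> n" and c: "c \<in> letters n A"
  shows "\<exists>v\<in>lists (letters (n - 1) A). \<exists>z\<in>entry A. \<exists>k\<in>{1..n}.
           last_row n y j @ [c] \<approx> v @ last_row n z k"
  using c
proof (cases rule: letters_cases)
  case (1 k)
  consider "k = j" | "j = Suc k" | "j < k" | "Suc k < j" by linarith
  then show ?thesis
  proof cases
    case 1
    then have "last_row n y j @ [c] = [] @ last_row n y (Suc j)"
      using \<open>c = S k\<close> j by (simp add: last_row_def up_Suc)
    then show ?thesis
      using y j 1 \<open>k < n\<close> by (metis Suc_leI atLeastAtMost_iff cong.refl le_SucI lists.Nil)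
  next
    case 2
    have "last_row n y j @ [c] \<approx> [] @ last_row n y k"
      using cong_context[OF s_square[of k], of "down n @ y @ up k" "[]"] 1 2
      by (simp add: last_row_def up_Suc)
    then show ?thesis
      using y 1 by (metis atLeastAtMost_iff less_imp_le lists.Nil)
  next
    case 3
    then have "[S (k - 1)] \<in> lists (letters (n - 1) A)"
      using 1 j S_in_letters[of "k - 1"] by simp
    moreover have "last_row n y j @ [c] \<approx> [S (k - 1)] @ last_row n y j"
      using last_row_s_shift[of y "k - 1" j c] up_s_far[of j k] 1 3 y j by simp
    ultimately show ?thesis
      using y j by (metis atLeastAtMost_iff)
  next
    case 4
    then have "[S k] \<in> lists (letters (n - 1) A)"
      using 1 j S_in_letters[of k] by simp
    moreover have "last_row n y j @ [c] \<approx> [S k] @ last_row n y j"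
      using last_row_s_shift[of y k j c] up_s[of k j] 1 4 y j by simp
    ultimately show ?thesis
      using y j by (metis atLeastAtMost_iff)
  qed
next
  case 2
  show ?thesis
  proof (cases "j = 1")
    case True
    obtain z where z: "z \<in> entry A" "y @ [c] \<approx> z"
      using entry_times_point[OF y 2(1)] by blast
    then have "last_row n y j @ [c] \<approx> [] @ last_row n z j"
      using cong_context[OF z(2), of "down n" "[]"] True by (simp add: last_row_def)
    then show ?thesis
      using z j by (metis atLeastAtMost_iff lists.Nil)
  next
    case False
    then have "last_row n y j @ [c] \<approx> [c] @ last_row n y j"
      using last_row_point_shift[OF y 2(1)] j by simp
    moreover have "[c] \<in> lists (letters (n - 1) A)"
      using False 2 j by (auto simp: letters_def wreath_letters_def point_letters_def)
    ultimately show ?thesis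
      using y j by (metis atLeastAtMost_iff)
  qed
qed

lemma normal_form:
  assumes "1 \<le> n" "u \<in> lists (letters n A)"
  shows "\<exists>v\<in>lists (letters (n - 1) A). \<exists>y\<in>entry A. \<exists>j\<in>{1..n}. u \<approx> v @ last_row n y j"
  using assms(2)
proof (induction u rule: rev_induct)
  case Nil
  have "[] \<approx> [] @ last_row n [] n"
    using cong.sym[OF down_up_cancel[of n]] assms(1) by (simp add: last_row_def)
  moreover have "[] \<in> entry A" by (simp add: entry_def)
  ultimately show ?case
    using assms(1) by (metis atLeastAtMost_iff le_refl lists.Nil)
next
  case (snoc c u)
  then obtain v y j where v: "v \<in> lists (letters (n - 1) A)" "y \<in> entry A" "j \<in> {1..n}"
    and u: "u \<approx> v @ last_row n y j"
    by (metis append_in_lists_conv)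
  obtain w z k where w: "w \<in> lists (letters (n - 1) A)" "z \<in> entry A" "k \<in> {1..n}"
    and eq: "last_row n y j @ [c] \<approx> w @ last_row n z k"
    using last_row_times_letter[of y j c] v snoc.prems
    by (metis atLeastAtMost_iff append_in_lists_conv Cons_in_lists_iff)
  have "u @ [c] \<approx> v @ last_row n y j @ [c]"
    using cong_context[OF u, of "[]" "[c]"] by simp
  also have "\<dots> \<approx> (v @ w) @ last_row n z k"
    using cong_context[OF eq, of v "[]"] by simp
  finally show ?case
    using v w by (metis append_in_lists_conv)
qed

text \<open>Both sides delete the rows \<open>1\<close> and \<open>n\<close>, and their underlying permutations differ only by the
  transposition of these rows. The word \<open>down n\<close> carries the two rows to the points \<open>2\<close> and
  \<open>1\<close>. After it has been moved to the front, both sides continue with \<open>e s\<^sub>1 e\<close>, and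
  the relation \<open>e s\<^sub>1 e s\<^sub>1 = e s\<^sub>1 e\<close> absorbs the transposition.\<close>

lemma zero_row_exchange:
  assumes jk: "1 \<le> j" "j \<le> k" "k < n"
  shows "[E] @ up k @ last_row n [E] j \<approx> [E] @ up j @ last_row n [E] (Suc k)"
proof -
  let ?V = "\<lambda>m. map (\<lambda>k. S (Suc k)) [1..<m]"
  have E: "E \<in> point_letters A" by (simp add: point_letters_def)
  have expand: "[E] @ up m @ last_row n [E] i \<approx> down n @ [E, S 1, E] @ ?V m @ up i"
    if m: "1 \<le> m" "m < n" for m i
  proof -
    have "up m @ down n \<approx> down n @ ?V m"
      unfolding up_def
      by (rule pass_letters) (use m in \<open>auto intro!: s_down[simplified]\<close>)
    from cong_context[OF this, of "[E]" "[E] @ up i"]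
    have "[E] @ up m @ last_row n [E] i \<approx> [E] @ down n @ ?V m @ [E] @ up i"
      by (simp add: last_row_def)
    also have "\<dots> \<approx> down n @ [S 1, E, S 1] @ ?V m @ [E] @ up i"
      using cong_context[OF point_down[OF E, of n], of "[]" "?V m @ [E] @ up i"] m by simp
    also have "\<dots> \<approx> down n @ [S 1, E, S 1] @ [E] @ ?V m @ up i"
    proof -
      have "?V m @ [E] \<approx> [E] @ ?V m"
        by (rule commute_letters) (use m point_s[OF E] in auto)
      from cong_context[OF this, of "down n @ [S 1, E, S 1]" "up i"] show ?thesis by simp
    qed
    also have "\<dots> \<approx> down n @ [E, S 1, E] @ ?V m @ up i"
      using cong_context[OF cong.sym[OF s_ese], of "down n" "?V m @ up i"] m by simp
    finally show ?thesis .
  qed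
  have "?V j @ up (Suc k) \<approx> up (Suc k) @ up j"
    unfolding up_def[of j]
    by (rule pass_letters) (use jk in \<open>auto intro!: cong.sym[OF up_s[simplified]]\<close>)
  moreover have "up (Suc k) = [S 1] @ ?V k"
    using up_Cons[of "Suc k"] jk
    by (simp add: numeral_2_eq_2 comp_def del: upt_Suc flip: map_Suc_upt)
  ultimately have V: "?V j @ up (Suc k) \<approx> [S 1] @ ?V k @ up j"
    by (metis append_assoc)
  have "[E] @ up j @ last_row n [E] (Suc k) \<approx> down n @ [E, S 1, E] @ ?V j @ up (Suc k)"
    using expand jk by simp
  also have "\<dots> \<approx> down n @ [E, S 1, E, S 1] @ ?V k @ up j"
    using cong_context[OF V, of "down n @ [E, S 1, E]" "[]"] by simp
  also have "\<dots> \<approx> down n @ [E, S 1, E] @ ?V k @ up j"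
    using cong_context[OF ese_s, of "down n" "?V k @ up j"] jk by simp
  also have "\<dots> \<approx> [E] @ up k @ last_row n [E] j"
    using cong.sym[OF expand[of k j]] jk by simp
  finally show ?thesis by (rule cong.sym)
qed

end

section \<open>The action of words on entries of a row\<close>

locale presented_monoid = monoid M for M :: "('m, 'b) monoid_scheme" (structure) +
  fixes A :: "'x set" and R :: "('x list \<times> 'x list) set" and \<phi> :: "'x list \<Rightarrow> 'm"
  assumes presentation: "has_presentation M A R \<phi>"
begin

lemma relations_in_lists: "R \<subseteq> lists A \<times> lists A"
  and \<phi>_surj: "\<phi> ` lists A = carrier M"
  and \<phi>_Nil: "\<phi> [] = \<one>"
  using presentation unfolding has_presentation_def by auto

lemma \<phi>_closed: "w \<in> lists A \<Longrightarrow> \<phi> w \<in> carrier M"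
  using \<phi>_surj by blast

lemma \<phi>_append: "u \<in> lists A \<Longrightarrow> v \<in> lists A \<Longrightarrow> \<phi> (u @ v) = \<phi> u \<otimes> \<phi> v"
  using presentation unfolding has_presentation_def hom_def free_monoid_def by auto

lemma \<phi>_eq_iff: "u \<in> lists A \<Longrightarrow> v \<in> lists A \<Longrightarrow> \<phi> u = \<phi> v \<longleftrightarrow> cong R u v"
  using presentation unfolding has_presentation_def
    generated_congruence_free_monoid[OF relations_in_lists] by blast

text \<open>A state \<open>(m, i)\<close> is an entry \<open>m\<close> of a row, standing in column \<open>i\<close>; the value \<^const>\<open>None\<close> is
  a zero row.\<close>

fun step :: "'x letter \<Rightarrow> 'm \<times> nat \<Rightarrow> ('m \<times> nat) option" where
  "step (LetS k) (m, i) = Some (m, transpose k (k + 1) i)"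
| "step LetE (m, i) = (if i = 1 then None else Some (m, i))"
| "step (LetX x) (m, i) = Some (if i = 1 then m \<otimes> \<phi> [x] else m, i)"

primrec run :: "'x letter list \<Rightarrow> 'm \<times> nat \<Rightarrow> ('m \<times> nat) option" where
  "run [] p = Some p"
| "run (c # w) p = Option.bind (step c p) (run w)"

definition states :: "nat \<Rightarrow> ('m \<times> nat) set" where
  "states n = carrier M \<times> {1..n}"

definition same_action :: "nat \<Rightarrow> 'x letter list \<Rightarrow> 'x letter list \<Rightarrow> bool" where
  "same_action n u v \<longleftrightarrow> (\<forall>p\<in>states n. run u p = run v p)"

lemma run_append: "run (u @ v) p = Option.bind (run u p) (run v)"
  by (induction u arbitrary: p) (auto split: Option.bind_split)

lemma step_states:
  "c \<in> letters n A \<Longrightarrow> p \<in> states n \<Longrightarrow> step c p = Some q \<Longrightarrow> q \<in> states n"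
  by (cases "(c, p)" rule: step.cases)
    (auto simp: states_def letters_def wreath_letters_def transpose_def \<phi>_closed split: if_splits)

lemma run_states:
  "u \<in> lists (letters n A) \<Longrightarrow> p \<in> states n \<Longrightarrow> run u p = Some q \<Longrightarrow> q \<in> states n"
  by (induction u arbitrary: p) (auto simp: bind_eq_Some_conv dest: step_states)

lemma step_scale:
  "c \<in> letters n A \<Longrightarrow> a \<in> carrier M \<Longrightarrow> m \<in> carrier M \<Longrightarrow>
    step c (a \<otimes> m, i) = map_option (apfst ((\<otimes>) a)) (step c (m, i))"
  by (cases c) (auto simp: letters_def wreath_letters_def \<phi>_closed m_assoc split: if_splits)

text \<open>Words multiply entries from the right, which commutes with multiplication from the left. So
  the action is determined by its values on the states with entry \<open>1\<close>.\<close>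

lemma run_scale:
  assumes "u \<in> lists (letters n A)" "a \<in> carrier M" "(m, i) \<in> states n"
  shows "run u (a \<otimes> m, i) = map_option (apfst ((\<otimes>) a)) (run u (m, i))"
  using assms(1,3)
proof (induction u arbitrary: m i)
  case (Cons c u)
  then have st: "step c (a \<otimes> m, i) = map_option (apfst ((\<otimes>) a)) (step c (m, i))"
    using assms(2) by (auto intro!: step_scale simp: states_def)
  show ?case
  proof (cases "step c (m, i)")
    case (Some q)
    obtain m' i' where q: "q = (m', i')" by fastforce
    have "(m', i') \<in> states n"
      using step_states[of c n "(m, i)" q] Some Cons q by simp
    then show ?thesis using Cons st Some q by simp
  qed (use st in simp)
qed simp

lemma same_action_at_one:
  assumes "u \<in> lists (letters n A)" "v \<in> lists (letters n A)"
    and "\<And>i. i \<in> {1..n} \<Longrightarrow> run u (\<one>, i) = run v (\<one>, i)"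
  shows "same_action n u v"
  unfolding same_action_def
proof
  fix p assume "p \<in> states n"
  then obtain m i where p: "p = (m, i)" "m \<in> carrier M" "i \<in> {1..n}"
    by (auto simp: states_def)
  then have "(\<one>, i) \<in> states n" by (simp add: states_def)
  then show "run u p = run v p"
    using run_scale[of u n m "\<one>" i] run_scale[of v n m "\<one>" i] assms p by simp
qed

lemma run_X_word:
  "w \<in> lists A \<Longrightarrow> m \<in> carrier M \<Longrightarrow> run (map X w) (m, i) = Some (if i = 1 then m \<otimes> \<phi> w else m, i)"
proof (induction w arbitrary: m)
  case (Cons x w)
  then show ?case
    using \<phi>_append[of "[x]" w] \<phi>_closed[of "[x]"] \<phi>_closed[of w] by (auto simp: m_assoc)
qed (simp add: \<phi>_Nil)

lemma wreath_relations_in_lists: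
  "1 \<le> n \<Longrightarrow> wreath_relations n A R \<subseteq> lists (letters n A) \<times> lists (letters n A)"
  using relations_in_lists
  unfolding wreath_relations_def letters_def wreath_letters_def Let_def
  by (fastforce split: if_splits)

lemma wreath_relations_same_action:
  assumes "(u, v) \<in> wreath_relations n A R" "1 \<le> n"
  shows "same_action n u v"
proof -
  have "run u (m, i) = run v (m, i)" if m: "m \<in> carrier M" for m i
  proof -
    have "run (map X u) (m, i) = run (map X v) (m, i)" if "(u, v) \<in> R" for u v
    proof -
      have "u \<in> lists A" "v \<in> lists A"
        using that relations_in_lists by auto
      moreover have "\<phi> u = \<phi> v"
        using \<phi>_eq_iff calculation that cong.base by metis
      ultimately show ?thesis using m by (simp add: run_X_word)
    qed
    then show ?thesis
      using assms m
      by (auto simp: wreath_relations_def Let_def transpose_def split: if_splits)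
  qed
  then show ?thesis by (auto simp: same_action_def states_def)
qed

text \<open>Having the same action is a congruence, because the action of a word leaves the set of states
  invariant, and it contains the defining relations.\<close>

lemma cong_same_action:
  assumes "cong (wreath_relations n A R) u v" "u \<in> lists (letters n A)" "1 \<le> n"
  shows "same_action n u v"
proof -
  let ?L = "lists (letters n A)"
  let ?K = "{(u, v). u \<in> ?L \<and> v \<in> ?L \<and> same_action n u v}"
  have "run (u @ w) p = run (v @ w) p" "run (w @ u) p = run (w @ v) p"
    if "same_action n u v" "w \<in> ?L" "p \<in> states n" for u v w p
    using that run_states[of w n p] unfolding same_action_def run_append
    by (auto split: Option.bind_split)
  then have "monoid_congruence (free_monoid (letters n A)) ?K"
    unfolding monoid_congruence_def free_monoid_def equiv_def refl_on_def sym_def trans_def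
    by (auto simp: same_action_def)
  moreover have "wreath_relations n A R \<subseteq> ?K"
    using wreath_relations_in_lists wreath_relations_same_action assms(3) by blast
  ultimately show ?thesis
    using cong_in_congruence[OF assms(1) wreath_relations_in_lists] assms by blast
qed

lemma run_down:
  "1 \<le> m \<Longrightarrow> 1 \<le> i \<Longrightarrow>
    run (down m) (a, i) = Some (a, if i = m then 1 else if i < m then Suc i else i)"
proof (induction m arbitrary: i rule: dec_induct)
  case (step m)
  then show ?case
    by (auto simp: down_Suc transpose_def)
qed simp

lemma run_up:
  "1 \<le> m \<Longrightarrow> 1 \<le> i \<Longrightarrow>
    run (up m) (a, i) = Some (a, if i = 1 then m else if i \<le> m then i - 1 else i)"
proof (induction m arbitrary: i rule: dec_induct)
  case (step m)
  then show ?case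
    by (auto simp: up_Suc run_append transpose_def)
qed simp

text \<open>The order-preserving bijection from \<open>{1..n - 1}\<close> onto \<open>{1..n} - {j}\<close>: the columns of the rows
  other than the last one.\<close>

definition skip :: "nat \<Rightarrow> nat \<Rightarrow> nat" where
  "skip j i = (if i < j then i else Suc i)"

lemma run_entry_other:
  "y \<in> lists (point_letters A) \<Longrightarrow> i \<noteq> 1 \<Longrightarrow> run y (a, i) = Some (a, i)"
  by (induction y) (auto simp: point_letters_def)

lemma entry_cases:
  assumes "y \<in> entry A"
  obtains "y = [E]" | w where "w \<in> lists A" "y = map X w"
  using assms by (auto simp: entry_def lists_image)

lemma entry_point: "y \<in> entry A \<Longrightarrow> y \<in> lists (point_letters A)"
  by (auto simp: entry_def point_letters_def)

lemma run_last_row_other: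
  assumes "y \<in> entry A" "i \<in> {1..<n}" "j \<in> {1..n}"
  shows "run (last_row n y j) (a, i) = Some (a, skip j i)"
  using assms run_entry_other[OF entry_point, of y "Suc i" a]
  by (auto simp: last_row_def run_append run_down run_up skip_def)

lemma run_last_row_zero:
  assumes "1 \<le> n"
  shows "run (last_row n [E] j) (a, n) = None"
  using assms by (simp add: last_row_def run_append run_down)

lemma run_last_row_word:
  assumes "w \<in> lists A" "a \<in> carrier M" "1 \<le> n" "1 \<le> j"
  shows "run (last_row n (map X w) j) (a, n) = Some (a \<otimes> \<phi> w, j)"
  using assms by (simp add: last_row_def run_append run_down run_up run_X_word)

lemma run_fixes_last:
  "v \<in> lists (letters (n - 1) A) \<Longrightarrow> 1 \<le> n \<Longrightarrow> run v (a, n) = Some (a, n)"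
proof (induction v)
  case (Cons c v)
  then have "step c (a, n) = Some (a, n)"
    by (cases c) (auto simp: letters_def wreath_letters_def transpose_def split: if_splits)
  then show ?case using Cons by simp
qed simp

text \<open>The words \<open>last_row n y j\<close> and \<open>last_row n z j\<close> act on the first \<open>n - 1\<close> columns by the same
  injection \<^term>\<open>skip j\<close>, so they can be cancelled there even though elements of \<open>M\<close> need
  not be cancellable.\<close>

lemma same_action_cancel_last_row:
  assumes "same_action n (u @ last_row n y j) (v @ last_row n z j)"
    and uv: "u \<in> lists (letters (n - 1) A)" "v \<in> lists (letters (n - 1) A)"
    and yz: "y \<in> entry A" "z \<in> entry A" and j: "j \<in> {1..n}"
  shows "same_action (n - 1) u v"
  unfolding same_action_def
proof
  fix p assume p: "p \<in> states (n - 1)"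
  have image: "run (w @ last_row n x j) p = map_option (apsnd (skip j)) (run w p)"
    if "w \<in> lists (letters (n - 1) A)" "x \<in> entry A" for w x
  proof (cases "run w p")
    case (Some q)
    then have "q \<in> states (n - 1)"
      using run_states that p by blast
    then show ?thesis
      using Some that j by (auto simp: run_append states_def run_last_row_other)
  qed (simp add: run_append)
  have "p \<in> states n"
    using p by (auto simp: states_def)
  then have "map_option (apsnd (skip j)) (run u p) = map_option (apsnd (skip j)) (run v p)"
    using assms(1) image[OF uv(1) yz(1)] image[OF uv(2) yz(2)] by (simp add: same_action_def)
  moreover have "inj (skip j)"
    by (auto simp: inj_def skip_def split: if_splits)
  then have "inj (map_option (apsnd (skip j) :: 'm \<times> nat \<Rightarrow> _))"
    by (intro option.inj_map) (auto simp: inj_def)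
  ultimately show "run u p = run v p"
    by (simp add: inj_eq)
qed

lemma letters_mono: "m \<le> n \<Longrightarrow> letters m A \<subseteq> letters n A"
  by (auto simp: letters_def wreath_letters_def)

lemma wreath_relations_mono: "m \<le> n \<Longrightarrow> wreath_relations m A R \<subseteq> wreath_relations n A R"
  unfolding wreath_relations_def Let_def by (intro Un_mono) auto

definition complete_at :: "nat \<Rightarrow> bool" where
  "complete_at n \<longleftrightarrow> (\<forall>u\<in>lists (letters n A). \<forall>v\<in>lists (letters n A).
     same_action n u v \<longrightarrow> cong (wreath_relations n A R) u v)"

text \<open>The relations of rank \<open>n - 1\<close> are among those of rank \<open>n\<close>, so a congruence found by the
  induction hypothesis persists.\<close>

lemma cong_of_smaller_action:
  assumes "complete_at (n - 1)" "same_action (n - 1) u v"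
    and "u \<in> lists (letters (n - 1) A)" "v \<in> lists (letters (n - 1) A)"
  shows "cong (wreath_relations n A R) u v"
  using assms cong_mono[OF _ wreath_relations_mono[of "n - 1" n]] by (auto simp: complete_at_def)

lemma last_row_in_lists:
  assumes "y \<in> entry A" "j \<in> {1..n}"
  shows "last_row n y j \<in> lists (letters n A)"
  using entry_point[OF assms(1)] assms(2)
  by (auto simp: last_row_def down_def up_def letters_def wreath_letters_def point_letters_def)

lemma cong_same_column:
  assumes IH: "complete_at (n - 1)"
    and act: "same_action n (u @ last_row n y j) (v @ last_row n z j)"
    and uv: "u \<in> lists (letters (n - 1) A)" "v \<in> lists (letters (n - 1) A)"
    and yz: "y \<in> entry A" "z \<in> entry A" and j: "j \<in> {1..n}"
    and y_z: "cong (wreath_relations n A R) y z"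
  shows "cong (wreath_relations n A R) (u @ last_row n y j) (v @ last_row n z j)"
  using cong_of_smaller_action[OF IH same_action_cancel_last_row[OF act uv yz j] uv]
    last_row_cong[OF y_z] by (rule cong.append)

text \<open>The word here represents the diagonal idempotent that deletes column \<open>k\<close>.\<close>

lemma run_kill_column:
  assumes "1 \<le> k" "1 \<le> i"
  shows "run (down k @ [E] @ up k) (a, i) = (if i = k then None else Some (a, i))"
  using assms by (auto simp: run_append run_down run_up)

text \<open>If \<open>j < k\<close>, no row of the matrix has its entry in column \<open>k\<close>: the rows before the last avoid
  it on the right-hand side, and the last row is zero. On the left-hand side, column
  \<open>k\<close> comes from column \<open>k - 1\<close> of \<open>u\<close>, so \<open>u\<close> has the same action as its product with the idempotent
  deleting column \<open>k - 1\<close>. The induction hypothesis makes these congruent, and then the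
  column \<open>j\<close> can be exchanged for \<open>k\<close>.\<close>

lemma cong_zero_last_row:
  assumes IH: "complete_at (n - 1)"
    and act: "same_action n (u @ last_row n [E] j) (v @ last_row n [E] k)"
    and uv: "u \<in> lists (letters (n - 1) A)" "v \<in> lists (letters (n - 1) A)"
    and jk: "j \<in> {1..n}" "k \<in> {1..n}" "j \<le> k"
  shows "cong (wreath_relations n A R) (u @ last_row n [E] j) (v @ last_row n [E] k)"
proof (cases "j = k")
  case True
  then show ?thesis
    using cong_same_column[OF IH] act uv jk by (simp add: entry_def)
next
  case False
  \<comment> \<open>As \<open>j < k\<close>, column \<open>k\<close> of the product is column \<open>k' = k - 1\<close> of \<open>u\<close>.\<close>
  obtain k' where k': "k = Suc k'" "j \<le> k'" "1 \<le> k'" "k' \<le> n - 1"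
    using False jk by (cases k) auto
  have E: "[E] \<in> entry A" by (simp add: entry_def)
  let ?kill = "down k' @ [E] @ up k'"
  have kill: "?kill \<in> lists (letters (n - 1) A)" "up j \<in> lists (letters (n - 1) A)"
    "down k' \<in> lists (letters (n - 1) A)" "[E] \<in> lists (letters (n - 1) A)"
    using k' jk by (auto simp: down_def up_def letters_def wreath_letters_def)
  have "same_action (n - 1) u (u @ ?kill)"
    unfolding same_action_def
  proof
    fix p assume p: "p \<in> states (n - 1)"
    then have pn: "p \<in> states n" by (auto simp: states_def)
    show "run u p = run (u @ ?kill) p"
    proof (cases "run u p")
      case (Some q)
      obtain a i where q: "q = (a, i)" by fastforce
      have i: "a \<in> carrier M" "i \<in> {1..n - 1}"
        using run_states[OF uv(1) p Some] q by (auto simp: states_def)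
      then have "i < n"
        using jk by auto
      then have "run (u @ last_row n [E] j) p = Some (a, skip j i)"
        using Some q jk i run_last_row_other[OF E, of i n j a] by (simp add: run_append)
      then have v: "run (v @ last_row n [E] k) p = Some (a, skip j i)"
        using act pn by (simp add: same_action_def)
      then obtain b l where l: "run v p = Some (b, l)"
        by (auto simp: run_append bind_eq_Some_conv)
      then have "l \<in> {1..<n}"
        using run_states[OF uv(2) p l] jk by (auto simp: states_def)
      then have "skip j i = skip k l"
        using v l jk run_last_row_other[OF E, of l n k b] by (simp add: run_append)
      \<comment> \<open>Here \<^term>\<open>skip j k' = k\<close>, and \<open>k\<close> is not a value of \<^term>\<open>skip k\<close>.\<close>
      then have "i \<noteq> k'"
        using k' by (auto simp: skip_def split: if_splits)
      then show ?thesis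
        using Some q i k' run_kill_column[of k' i a] by (simp add: run_append)
    qed (simp add: run_append)
  qed
  then have "cong (wreath_relations n A R) u (u @ ?kill)"
    using cong_of_smaller_action[OF IH] uv kill by simp
  from cong_context[OF this, of "[]" "last_row n [E] j"]
  have "cong (wreath_relations n A R) (u @ last_row n [E] j)
      ((u @ down k') @ [E] @ up k' @ last_row n [E] j)" by simp
  also have "cong (wreath_relations n A R) \<dots>
      ((u @ down k' @ [E] @ up j) @ last_row n [E] k)"
    using cong_context[OF zero_row_exchange[of j k' n A R], of "u @ down k'" "[]"] k' jk by simp
  finally have shifted: "cong (wreath_relations n A R) (u @ last_row n [E] j)
      ((u @ down k' @ [E] @ up j) @ last_row n [E] k)" .
  have n: "1 \<le> n" and ul: "u @ last_row n [E] j \<in> lists (letters n A)"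
    using jk last_row_in_lists[OF E jk(1)] uv(1) lists_mono[OF letters_mono[of "n - 1" n]] by auto
  from shifted have "same_action n (u @ last_row n [E] j)
      ((u @ down k' @ [E] @ up j) @ last_row n [E] k)"
    using cong_same_action ul n by blast
  then have "same_action n ((u @ down k' @ [E] @ up j) @ last_row n [E] k)
      (v @ last_row n [E] k)"
    using act by (simp add: same_action_def)
  then have "cong (wreath_relations n A R)
      ((u @ down k' @ [E] @ up j) @ last_row n [E] k) (v @ last_row n [E] k)"
    using uv kill jk E by (intro cong_same_column[OF IH]) auto
  with shifted show ?thesis by (rule cong.trans)
qed

lemma same_action_sym: "same_action n u v \<Longrightarrow> same_action n v u"
  by (simp add: same_action_def)

lemma completeness: "complete_at n"
proof (induction n)
  case 0
  then show ?case by (auto simp: complete_at_def letters_def)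
next
  case (Suc n')
  define n where "n = Suc n'"
  have n: "1 \<le> n" and IH: "complete_at (n - 1)"
    using Suc by (simp_all add: n_def)
  have "cong (wreath_relations n A R) u v"
    if uv: "u \<in> lists (letters n A)" "v \<in> lists (letters n A)" and act: "same_action n u v" for u v
  proof -
    obtain u' y j where u': "u' \<in> lists (letters (n - 1) A)" "y \<in> entry A" "j \<in> {1..n}"
      and u: "cong (wreath_relations n A R) u (u' @ last_row n y j)"
      using normal_form[OF n uv(1)] by blast
    obtain v' z k where v': "v' \<in> lists (letters (n - 1) A)" "z \<in> entry A" "k \<in> {1..n}"
      and v: "cong (wreath_relations n A R) v (v' @ last_row n z k)"
      using normal_form[OF n uv(2)] by blast
    have act': "same_action n (u' @ last_row n y j) (v' @ last_row n z k)"
      using act cong_same_action[OF u uv(1) n] cong_same_action[OF v uv(2) n]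
      by (simp add: same_action_def)
    have "(\<one>, n) \<in> states n"
      using n by (simp add: states_def)
    then have last: "run (last_row n y j) (\<one>, n) = run (last_row n z k) (\<one>, n)"
      using act' run_fixes_last[OF u'(1) n] run_fixes_last[OF v'(1) n]
      unfolding same_action_def run_append by force
    have "cong (wreath_relations n A R) (u' @ last_row n y j) (v' @ last_row n z k)"
    proof (cases rule: entry_cases[OF u'(2)])
      case 1
      then have "z = [E]"
        using last n v'(3) by (cases rule: entry_cases[OF v'(2)])
          (auto simp: run_last_row_zero run_last_row_word)
      then show ?thesis
        using cong_zero_last_row[OF IH _ u'(1) v'(1) u'(3) v'(3)] act' 1
          cong.sym[OF cong_zero_last_row[OF IH _ v'(1) u'(1) v'(3) u'(3)]] same_action_sym
        by (metis linear)
    next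
      case (2 w)
      then have row_y: "run (last_row n y j) (\<one>, n) = Some (\<phi> w, j)"
        using run_last_row_word[of w \<one> n j] n u'(3) \<phi>_closed by simp
      then obtain x where x: "x \<in> lists A" "z = map X x"
        using last n by (cases rule: entry_cases[OF v'(2)]) (auto simp: run_last_row_zero)
      then have "\<phi> w = \<phi> x" "j = k"
        using row_y last run_last_row_word[of x \<one> n k] n v'(3) \<phi>_closed by auto
      then have "cong (wreath_relations n A R) y z"
        using 2 x \<phi>_eq_iff image_relation by metis
      then show ?thesis
        using cong_same_column[OF IH] act' u' v' \<open>j = k\<close> by blast
    qed
    then show ?thesis
      using u v by (meson cong.sym cong.trans)
  qed
  then show ?case by (simp add: complete_at_def n_def)
qed

lemma cong_iff_same_action:
  assumes "1 \<le> n" "u \<in> lists (letters n A)" "v \<in> lists (letters n A)"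
  shows "cong (wreath_relations n A R) u v \<longleftrightarrow> same_action n u v"
  using assms completeness cong_same_action unfolding complete_at_def by blast

text \<open>A nonzero last row fixes the column \<open>j\<close>. For a zero last row any column not used by the other
  rows will do, and one exists since \<open>n\<close> rows cannot occupy \<open>n + 1\<close> columns.\<close>

lemma realize_rows:
  assumes "\<And>i a j. i \<in> {1..n} \<Longrightarrow> g i = Some (a, j) \<Longrightarrow> a \<in> carrier M \<and> j \<in> {1..n}"
    and "\<And>i i' a b j. i \<in> {1..n} \<Longrightarrow> i' \<in> {1..n} \<Longrightarrow> g i = Some (a, j) \<Longrightarrow> g i' = Some (b, j) \<Longrightarrow> i = i'"
  shows "\<exists>u\<in>lists (letters n A). \<forall>i\<in>{1..n}. run u (\<one>, i) = g i"
  using assms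
proof (induction n arbitrary: g)
  case 0
  show ?case by (intro bexI[of _ "[]"]) auto
next
  case (Suc n)
  have "\<exists>y\<in>entry A. \<exists>j\<in>{1..Suc n}. (\<forall>i\<in>{1..n}. \<forall>a. g i \<noteq> Some (a, j)) \<and>
      run (last_row (Suc n) y j) (\<one>, Suc n) = g (Suc n)"
  proof (cases "g (Suc n)")
    case None
    have "card ((\<lambda>i. snd (the (g i))) ` {1..n}) < card {1..Suc n}"
      using card_image_le[of "{1..n}" "\<lambda>i. snd (the (g i))"] by simp
    then obtain j where j: "j \<in> {1..Suc n}" "j \<notin> (\<lambda>i. snd (the (g i))) ` {1..n}"
      by (metis card_mono finite_atLeastAtMost finite_imageI leD subsetI)
    have "g i \<noteq> Some (a, j)" if "i \<in> {1..n}" for i a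
    proof
      assume "g i = Some (a, j)"
      then have "j = snd (the (g i))" by simp
      then show False
        using j(2) that by blast
    qed
    moreover have "run (last_row (Suc n) [E] j) (\<one>, Suc n) = g (Suc n)"
      using None by (simp add: run_last_row_zero)
    ultimately have "(\<forall>i\<in>{1..n}. \<forall>a. g i \<noteq> Some (a, j)) \<and>
        run (last_row (Suc n) [E] j) (\<one>, Suc n) = g (Suc n)"
      by blast
    then have "\<exists>j\<in>{1..Suc n}. (\<forall>i\<in>{1..n}. \<forall>a. g i \<noteq> Some (a, j)) \<and>
        run (last_row (Suc n) [E] j) (\<one>, Suc n) = g (Suc n)"
      using j(1) by (rule bexI)
    then show ?thesis
      by (rule bexI) (simp add: entry_def)
  next
    case (Some q)
    obtain a j where q: "q = (a, j)" by fastforce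
    have aj: "a \<in> carrier M" "j \<in> {1..Suc n}"
      using Suc.prems(1)[of "Suc n" a j] Some q by auto
    then have "a \<in> \<phi> ` lists A"
      by (simp only: \<phi>_surj)
    then obtain w where w: "w \<in> lists A" "\<phi> w = a"
      by blast
    have "g i \<noteq> Some (b, j)" if "i \<in> {1..n}" for i b
    proof
      assume "g i = Some (b, j)"
      then have "i = Suc n"
        using Suc.prems(2)[of i "Suc n" b j a] that Some q by simp
      then show False
        using that by simp
    qed
    moreover have "run (last_row (Suc n) (map X w) j) (\<one>, Suc n) = g (Suc n)"
      using run_last_row_word[of w \<one> "Suc n" j] w aj Some q by simp
    ultimately have "(\<forall>i\<in>{1..n}. \<forall>a. g i \<noteq> Some (a, j)) \<and>
        run (last_row (Suc n) (map X w) j) (\<one>, Suc n) = g (Suc n)"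
      by blast
    then have "\<exists>j\<in>{1..Suc n}. (\<forall>i\<in>{1..n}. \<forall>a. g i \<noteq> Some (a, j)) \<and>
        run (last_row (Suc n) (map X w) j) (\<one>, Suc n) = g (Suc n)"
      using aj(2) by (rule bexI)
    then show ?thesis
      by (rule bexI) (use w in \<open>auto simp: entry_def\<close>)
  qed
  then obtain y j where y: "y \<in> entry A" and j: "j \<in> {1..Suc n}"
    and free: "\<And>i a. i \<in> {1..n} \<Longrightarrow> g i \<noteq> Some (a, j)"
    and last: "run (last_row (Suc n) y j) (\<one>, Suc n) = g (Suc n)"
    by blast
  \<comment> \<open>Deleting column \<open>j\<close> from the first \<open>n\<close> rows leaves a matrix of rank \<open>n\<close>.\<close>
  define unskip where "unskip l = (if l < j then l else l - 1)" for l
  define h where "h i = map_option (apsnd unskip) (g i)" for i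
  have h: "\<exists>l. g i = Some (a, l) \<and> l \<noteq> j \<and> l \<in> {1..Suc n} \<and> a \<in> carrier M \<and> k = unskip l"
    if i: "i \<in> {1..n}" and hi: "h i = Some (a, k)" for i a k
  proof -
    obtain b l where l: "g i = Some (b, l)" "b = a" "k = unskip l"
      using hi by (auto simp: h_def)
    then show ?thesis
      using free[OF i, of b] Suc.prems(1)[of i b l] i by auto
  qed
  have skip_unskip: "skip j (unskip l) = l" if "l \<noteq> j" for l
    using that j by (auto simp: skip_def unskip_def)
  have "\<exists>u\<in>lists (letters n A). \<forall>i\<in>{1..n}. run u (\<one>, i) = h i"
  proof (rule Suc.IH)
    fix i a k assume "i \<in> {1..n}" "h i = Some (a, k)"
    then show "a \<in> carrier M \<and> k \<in> {1..n}"
      using h[of i a k] j by (auto simp: unskip_def)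
  next
    fix i i' a b k
    assume i: "i \<in> {1..n}" "i' \<in> {1..n}" "h i = Some (a, k)" "h i' = Some (b, k)"
    then obtain l where "g i = Some (a, l)" "g i' = Some (b, l)"
      using h[of i a k] h[of i' b k] skip_unskip by metis
    then show "i = i'"
      using Suc.prems(2)[of i i' a l b] i by simp
  qed
  then obtain u where u: "u \<in> lists (letters n A)" "\<And>i. i \<in> {1..n} \<Longrightarrow> run u (\<one>, i) = h i"
    by blast
  have "run (u @ last_row (Suc n) y j) (\<one>, i) = g i" if i: "i \<in> {1..Suc n}" for i
  proof (cases "i = Suc n")
    case True
    then show ?thesis
      using run_fixes_last[of u "Suc n" \<one>] u(1) last by (simp add: run_append)
  next
    case False
    then have i: "i \<in> {1..n}" using i by simp
    show ?thesis
    proof (cases "h i")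
      case None
      then show ?thesis
        using u(2)[OF i] by (simp add: run_append h_def)
    next
      case (Some q)
      obtain a k where q: "q = (a, k)" by fastforce
      obtain l where l: "g i = Some (a, l)" "l \<noteq> j" "l \<in> {1..Suc n}" "k = unskip l"
        using h[OF i] Some q by blast
      moreover have "k \<in> {1..n}"
        using l j by (auto simp: unskip_def)
      ultimately show ?thesis
        using u(2)[OF i] Some q y j skip_unskip run_last_row_other[of y k "Suc n" j a]
        by (simp add: run_append)
    qed
  qed
  moreover have "u @ last_row (Suc n) y j \<in> lists (letters (Suc n) A)"
    using u(1) last_row_in_lists[OF y j] lists_mono[OF letters_mono[of n "Suc n"]] by auto
  ultimately show ?case by blast
qed

section \<open>The wreath product as the image of the free monoid\<close>

text \<open>The image of a word in the wreath product, assembled from the rows of its matrix.\<close>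

definition element :: "nat \<Rightarrow> 'x letter list \<Rightarrow> (nat \<Rightarrow> 'm option) \<times> (nat \<rightharpoonup> nat)" where
  "element n u =
    (\<lambda>i\<in>{1..n}. map_option fst (run u (\<one>, i)),
     \<lambda>i. if i \<in> {1..n} then map_option snd (run u (\<one>, i)) else None)"

lemma element_Nil: "element n [] = \<one>\<^bsub>wreath M n\<^esub>"
  by (auto simp: element_def wreath_def zero_power_def adjoin_zero_def sym_inv_monoid_def
      id_part_def restrict_map_def)

lemma element_letter:
  "c \<in> letters n A \<Longrightarrow> element n [c] = wreath_letter_image M n \<phi> c"
  by (cases c) (auto simp: element_def id_part_def restrict_map_def letters_def wreath_letters_def
      \<phi>_closed fun_eq_iff split: if_splits)

text \<open>Row \<open>i\<close> of a product arises by running \<open>v\<close> from the state \<open>(a, j)\<close> that \<open>u\<close> reaches from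
  \<open>(1, i)\<close>. By \<open>run_scale\<close> this is row \<open>j\<close> of \<open>v\<close> multiplied by \<open>a\<close>, as in the product of
  the wreath product.\<close>

lemma element_append:
  assumes "u \<in> lists (letters n A)" "v \<in> lists (letters n A)"
  shows "element n (u @ v) = element n u \<otimes>\<^bsub>wreath M n\<^esub> element n v"
proof -
  have "map_option fst (run (u @ v) (\<one>, i)) =
      fst (element n u) i \<otimes>\<^bsub>adjoin_zero M\<^esub> act n (snd (element n u)) (fst (element n v)) i \<and>
      map_option snd (run (u @ v) (\<one>, i)) = (snd (element n v) \<circ>\<^sub>m snd (element n u)) i"
    if i: "i \<in> {1..n}" for i
  proof (cases "run u (\<one>, i)")
    case None
    then show ?thesis
      using i by (simp add: run_append element_def adjoin_zero_def map_comp_def)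
  next
    case (Some q)
    obtain a j where q: "q = (a, j)" by fastforce
    have aj: "a \<in> carrier M" "j \<in> {1..n}"
      using run_states[OF assms(1) _ Some] i q by (auto simp: states_def)
    then have "run v (a, j) = map_option (apfst ((\<otimes>) a)) (run v (\<one>, j))"
      using run_scale[OF assms(2), of a \<one> j] by (simp add: states_def)
    then show ?thesis
      using i aj Some q
      by (cases "run v (\<one>, j)")
        (simp_all add: run_append element_def act_def adjoin_zero_def map_comp_def)
  qed
  moreover have "(snd (element n v) \<circ>\<^sub>m snd (element n u)) i = None" if "i \<notin> {1..n}" for i
    using that unfolding element_def map_comp_def by auto
  ultimately show ?thesis
    unfolding wreath_def zero_power_def sym_inv_monoid_def element_def[of n "u @ v"]
    by (simp add: case_prod_beta fun_eq_iff restrict_def del: atLeastAtMost_iff)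
qed

lemma word_morphism_element:
  "u \<in> lists (letters n A) \<Longrightarrow>
    word_morphism (wreath M n) (wreath_letter_image M n \<phi>) u = element n u"
proof (induction u)
  case (Cons c u)
  then have "word_morphism (wreath M n) (wreath_letter_image M n \<phi>) (c # u) =
      element n [c] \<otimes>\<^bsub>wreath M n\<^esub> element n u"
    by (simp add: word_morphism_def element_letter)
  also have "\<dots> = element n (c # u)"
    using element_append[of "[c]" n u] Cons.prems by simp
  finally show ?case .
qed (simp add: word_morphism_def element_Nil)

lemma element_eq_iff:
  assumes "u \<in> lists (letters n A)" "v \<in> lists (letters n A)"
  shows "element n u = element n v \<longleftrightarrow> same_action n u v"
proof
  assume eq: "element n u = element n v"
  have "run u (\<one>, i) = run v (\<one>, i)" if i: "i \<in> {1..n}" for i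
  proof -
    have "map_option fst (run u (\<one>, i)) = map_option fst (run v (\<one>, i))"
      "map_option snd (run u (\<one>, i)) = map_option snd (run v (\<one>, i))"
      using fun_cong[OF arg_cong[OF eq, of fst], of i] fun_cong[OF arg_cong[OF eq, of snd], of i] i
      by (simp_all add: element_def)
    then show ?thesis
      by (cases "run u (\<one>, i)"; cases "run v (\<one>, i)") (auto simp: prod_eq_iff)
  qed
  then show "same_action n u v"
    by (rule same_action_at_one[OF assms])
next
  assume "same_action n u v"
  then have "run u (\<one>, i) = run v (\<one>, i)" if "i \<in> {1..n}" for i
    using that by (simp add: same_action_def states_def)
  then show "element n u = element n v"
    by (auto simp: element_def intro!: restrict_ext)
qed

text \<open>Every letter acts on columns by an injective partial map; this gives the injectivity required
  of the second component of an element of the wreath product.\<close>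

lemma run_injective:
  "run u (a, i) = Some (b, k) \<Longrightarrow> run u (a', i') = Some (b', k) \<Longrightarrow> i = i'"
proof (induction u arbitrary: a i a' i')
  case (Cons c u)
  then obtain p q where "step c (a, i) = Some p" "step c (a', i') = Some q"
    "run u p = Some (b, k)" "run u q = Some (b', k)"
    by (auto simp: bind_eq_Some_conv)
  moreover from this have "snd p = snd q"
    using Cons.IH[of "fst p" "snd p" "fst q" "snd q"] by simp
  ultimately show ?case
    by (cases c) (auto split: if_splits dest: transpose_eq_imp_eq)
qed simp

lemma element_image: "element n ` lists (letters n A) = carrier (wreath M n)"
proof
  show "element n ` lists (letters n A) \<subseteq> carrier (wreath M n)"
  proof
    fix g assume "g \<in> element n ` lists (letters n A)"
    then obtain u where u: "u \<in> lists (letters n A)" "g = element n u"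
      by blast
    have closed: "a \<in> carrier M \<and> j \<in> {1..n}"
      if "i \<in> {1..n}" "run u (\<one>, i) = Some (a, j)" for i a j
      using run_states[OF u(1) _ that(2)] that(1) by (auto simp: states_def)
    have "fst g \<in> carrier (zero_power M n)"
    proof -
      have "map_option fst (run u (\<one>, i)) \<in> insert None (Some ` carrier M)"
        if "i \<in> {1..n}" for i
        using closed[OF that] by (cases "run u (\<one>, i)") auto
      then show ?thesis
        by (simp add: u zero_power_def element_def adjoin_zero_def PiE_iff)
    qed
    moreover have "dom (snd g) \<subseteq> {1..n}" "supp n (fst g) = dom (snd g)"
      by (auto simp: u element_def supp_def dom_def split: if_splits)
    moreover have "ran (snd g) \<subseteq> {1..n}"
    proof
      fix j assume "j \<in> ran (snd g)"
      then obtain i where "snd g i = Some j"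
        by (auto simp: ran_def)
      then obtain a where "i \<in> {1..n}" "run u (\<one>, i) = Some (a, j)"
        by (auto simp: u element_def split: if_splits)
      then show "j \<in> {1..n}"
        using closed by blast
    qed
    moreover have "inj_on (snd g) (dom (snd g))"
    proof (rule inj_onI)
      fix i i' assume i: "i \<in> dom (snd g)" "i' \<in> dom (snd g)" "snd g i = snd g i'"
      then obtain j where "snd g i = Some j" "snd g i' = Some j"
        by (auto simp: dom_def)
      then have "map_option snd (run u (\<one>, i)) = Some j" "map_option snd (run u (\<one>, i')) = Some j"
        by (simp_all add: u element_def split: if_splits)
      then obtain a b where "run u (\<one>, i) = Some (a, j)" "run u (\<one>, i') = Some (b, j)"
        by auto
      then show "i = i'"
        by (rule run_injective)
    qed
    ultimately show "g \<in> carrier (wreath M n)"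
      by (simp add: wreath_def sym_inv_monoid_def case_prod_beta)
  qed
  show "carrier (wreath M n) \<subseteq> element n ` lists (letters n A)"
  proof
    fix g assume "g \<in> carrier (wreath M n)"
    then obtain a \<alpha> where g: "g = (a, \<alpha>)"
      and a: "a \<in> (\<Pi>\<^sub>E i\<in>{1..n}. insert None (Some ` carrier M))"
      and \<alpha>: "dom \<alpha> \<subseteq> {1..n}" "ran \<alpha> \<subseteq> {1..n}" "inj_on \<alpha> (dom \<alpha>)"
      and supp: "supp n a = dom \<alpha>"
      by (auto simp: wreath_def zero_power_def adjoin_zero_def sym_inv_monoid_def)
    define r where "r i = map_option (\<lambda>j. (the (a i), j)) (\<alpha> i)" for i
    have "\<exists>u\<in>lists (letters n A). \<forall>i\<in>{1..n}. run u (\<one>, i) = r i"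
    proof (rule realize_rows)
      fix i b j assume i: "i \<in> {1..n}" "r i = Some (b, j)"
      then have "\<alpha> i = Some j" "b = the (a i)"
        by (auto simp: r_def)
      moreover from this have "a i \<noteq> None"
        using supp by (auto simp: supp_def)
      moreover have "a i \<in> insert None (Some ` carrier M)"
        using PiE_mem[OF a i(1)] .
      ultimately show "b \<in> carrier M \<and> j \<in> {1..n}"
        using \<alpha>(2) by (auto simp: ran_def)
    next
      fix i i' b c j assume "r i = Some (b, j)" "r i' = Some (c, j)"
      then have "\<alpha> i = Some j" "\<alpha> i' = Some j"
        by (auto simp: r_def)
      then show "i = i'"
        using inj_onD[OF \<alpha>(3), of i i'] by auto
    qed
    then obtain u where u: "u \<in> lists (letters n A)" "\<And>i. i \<in> {1..n} \<Longrightarrow> run u (\<one>, i) = r i"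
      by blast
    have "map_option fst (r i) = a i" "map_option snd (r i) = \<alpha> i" if i: "i \<in> {1..n}" for i
    proof -
      have "a i = None \<longleftrightarrow> \<alpha> i = None"
        using eqset_imp_iff[OF supp, of i] i by (auto simp: supp_def)
      then show "map_option fst (r i) = a i" "map_option snd (r i) = \<alpha> i"
        by (cases "\<alpha> i"; auto simp: r_def)+
    qed
    moreover have "\<alpha> i = None" "a i = undefined" if "i \<notin> {1..n}" for i
      using that \<alpha>(1) PiE_arb[OF a, of i] by auto
    ultimately have "element n u = g"
      using u(2) by (auto simp: element_def g fun_eq_iff restrict_def)
    then show "g \<in> element n ` lists (letters n A)"
      using u(1) by blast
  qed
qed

text \<open>The wreath product is the image of the free monoid under a map that respects products
  (\<open>element_append\<close>, \<open>element_image\<close>), so it inherits the monoid laws.\<close>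

lemma monoid_wreath: "monoid (wreath M n)"
proof (rule monoidI)
  fix f g h assume "f \<in> carrier (wreath M n)" "g \<in> carrier (wreath M n)" "h \<in> carrier (wreath M n)"
  then obtain u v w where "u \<in> lists (letters n A)" "v \<in> lists (letters n A)" "w \<in> lists (letters n A)"
    "f = element n u" "g = element n v" "h = element n w"
    unfolding element_image[symmetric] by blast
  then show "f \<otimes>\<^bsub>wreath M n\<^esub> g \<otimes>\<^bsub>wreath M n\<^esub> h = f \<otimes>\<^bsub>wreath M n\<^esub> (g \<otimes>\<^bsub>wreath M n\<^esub> h)"
    by (simp flip: element_append add: append_in_lists_conv)
next
  fix f g assume "f \<in> carrier (wreath M n)" "g \<in> carrier (wreath M n)"
  then obtain u v where "u \<in> lists (letters n A)" "v \<in> lists (letters n A)"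
    "f = element n u" "g = element n v"
    unfolding element_image[symmetric] by blast
  then have "f \<otimes>\<^bsub>wreath M n\<^esub> g = element n (u @ v)" "u @ v \<in> lists (letters n A)"
    by (simp_all add: element_append)
  then show "f \<otimes>\<^bsub>wreath M n\<^esub> g \<in> carrier (wreath M n)"
    unfolding element_image[symmetric] by blast
next
  show "\<one>\<^bsub>wreath M n\<^esub> \<in> carrier (wreath M n)"
    unfolding element_image[symmetric] element_Nil[symmetric] by blast
next
  fix f assume "f \<in> carrier (wreath M n)"
  then show "\<one>\<^bsub>wreath M n\<^esub> \<otimes>\<^bsub>wreath M n\<^esub> f = f" "f \<otimes>\<^bsub>wreath M n\<^esub> \<one>\<^bsub>wreath M n\<^esub> = f"
  proof -
    obtain u where u: "u \<in> lists (letters n A)" "f = element n u"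
      using \<open>f \<in> carrier (wreath M n)\<close> unfolding element_image[symmetric] by blast
    then show "\<one>\<^bsub>wreath M n\<^esub> \<otimes>\<^bsub>wreath M n\<^esub> f = f" "f \<otimes>\<^bsub>wreath M n\<^esub> \<one>\<^bsub>wreath M n\<^esub> = f"
      using element_append[of "[]" n u] element_append[of u n "[]"] by (simp_all add: element_Nil)
  qed
qed

lemma wreath_presentation:
  assumes "1 \<le> n"
  shows "has_presentation (wreath M n) (wreath_letters n A) (wreath_relations n A R)
    (word_morphism (wreath M n) (wreath_letter_image M n \<phi>))"
proof -
  let ?\<phi>' = "word_morphism (wreath M n) (wreath_letter_image M n \<phi>)"
  have L: "wreath_letters n A = letters n A"
    using assms by (simp add: letters_def)
  note element = word_morphism_element[of _ n]
  have "?\<phi>' ` lists (letters n A) = carrier (wreath M n)"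
    using element_image[of n] element by (metis (no_types, lifting) image_cong)
  moreover have "?\<phi>' (u @ v) = ?\<phi>' u \<otimes>\<^bsub>wreath M n\<^esub> ?\<phi>' v"
    if "u \<in> lists (letters n A)" "v \<in> lists (letters n A)" for u v
    using that element element_append by (metis append_in_lists_conv)
  ultimately have "?\<phi>' \<in> hom (free_monoid (letters n A)) (wreath M n)"
    "?\<phi>' ` lists (letters n A) = carrier (wreath M n)"
    unfolding hom_def free_monoid_def by auto
  moreover have "{(u, v). u \<in> lists (letters n A) \<and> v \<in> lists (letters n A) \<and> ?\<phi>' u = ?\<phi>' v} =
      generated_congruence (free_monoid (letters n A)) (wreath_relations n A R)"
  proof -
    have "?\<phi>' u = ?\<phi>' v \<longleftrightarrow> cong (wreath_relations n A R) u v"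
      if "u \<in> lists (letters n A)" "v \<in> lists (letters n A)" for u v
      using that element element_eq_iff cong_iff_same_action[OF assms] by simp
    then show ?thesis
      unfolding generated_congruence_free_monoid[OF wreath_relations_in_lists[OF assms]] by blast
  qed
  ultimately show ?thesis
    using monoid_wreath wreath_relations_in_lists[OF assms]
    unfolding has_presentation_def L by (simp add: word_morphism_def)
qed

end

theorem theorem3p29:
  fixes M :: "('m, 'b) monoid_scheme"
    and XM :: "'x set"
    and RM :: "('x list \<times> 'x list) set"
    and \<phi>M :: "'x list \<Rightarrow> 'm"
    and n :: nat
  assumes "monoid M"
    and "has_presentation M XM RM \<phi>M"
    and "n \<ge> 1"
  shows "has_presentation (wreath M n) (wreath_letters n XM) (wreath_relations n XM RM)
           (word_morphism (wreath M n) (wreath_letter_image M n \<phi>M))"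
proof -
  interpret presented_monoid M XM RM \<phi>M
    using assms by (simp add: presented_monoid_def presented_monoid_axioms_def)
  show ?thesis
    using assms(3) by (rule wreath_presentation)
qed

end
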